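(* Let $(X,\tau)$ and $(Y,\sigma)$ be topological spaces and let $f \colon (X,\tau) \rightarrow (Y,\sigma)$ be a function. The following conditions are equivalent: (1) $f$ is completely continuous. (2) $f$ is precontinuous and contra-semicontinuous.
   Context: No separation axioms are assumed and functions are not assumed continuous. For a subset $A$ of a topological space, $\mathrm{Int}(A)$ and $\mathrm{Cl}(A)$ denote interior and closure. $A$ is semi-open if $A \subseteq \mathrm{Cl}(\mathrm{Int}(A))$; semi-closed if its complement is semi-open (equivalently $\mathrm{Int}(\mathrm{Cl}(A)) \subseteq A$); regular open if $A = \mathrm{Int}(\mathrm{Cl}(A))$; preopen if $A \subseteq \mathrm{Int}(\mathrm{Cl}(A))$. A function $f \colon (X,\tau)\to(Y,\sigma)$ is completely continuous (resp. precontinuous, contra-semicontinuous) if the preimage of every open subset of $Y$ is regular open (resp. preopen, semi-closed) in $X$. *)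

theory Defs
  imports "HOL-Analysis.Abstract_Topology"
begin

definition semiopenin :: "'a topology \<Rightarrow> 'a set \<Rightarrow> bool" where
  "semiopenin X A \<longleftrightarrow> A \<subseteq> X closure_of (X interior_of A)"

definition semiclosedin :: "'a topology \<Rightarrow> 'a set \<Rightarrow> bool" where
  "semiclosedin X A \<longleftrightarrow> A \<subseteq> topspace X \<and> semiopenin X (topspace X - A)"

definition regular_openin :: "'a topology \<Rightarrow> 'a set \<Rightarrow> bool" where
  "regular_openin X A \<longleftrightarrow> A = X interior_of (X closure_of A)"

definition preopenin :: "'a topology \<Rightarrow> 'a set \<Rightarrow> bool" where
  "preopenin X A \<longleftrightarrow> A \<subseteq> X interior_of (X closure_of A)"

(* The classes of maps below follow the pattern of continuous_map: f maps topspace X into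
   topspace Y, and preimages are taken within topspace X. *)

definition completely_continuous_map :: "'a topology \<Rightarrow> 'b topology \<Rightarrow> ('a \<Rightarrow> 'b) \<Rightarrow> bool" where
  "completely_continuous_map X Y f \<longleftrightarrow>
     f \<in> topspace X \<rightarrow> topspace Y \<and>
     (\<forall>U. openin Y U \<longrightarrow> regular_openin X {x \<in> topspace X. f x \<in> U})"

definition precontinuous_map :: "'a topology \<Rightarrow> 'b topology \<Rightarrow> ('a \<Rightarrow> 'b) \<Rightarrow> bool" where
  "precontinuous_map X Y f \<longleftrightarrow>
     f \<in> topspace X \<rightarrow> topspace Y \<and>
     (\<forall>U. openin Y U \<longrightarrow> preopenin X {x \<in> topspace X. f x \<in> U})"

definition contra_semicontinuous_map :: "'a topology \<Rightarrow> 'b topology \<Rightarrow> ('a \<Rightarrow> 'b) \<Rightarrow> bool" where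
  "contra_semicontinuous_map X Y f \<longleftrightarrow>
     f \<in> topspace X \<rightarrow> topspace Y \<and>
     (\<forall>U. openin Y U \<longrightarrow> semiclosedin X {x \<in> topspace X. f x \<in> U})"

end

theory Submission
  imports Defs
begin

text \<open>Regular openness is the equality of \<open>A\<close> with the interior of its closure.
  Preopenness is one inclusion of it; semi-closedness, by complementation, is the other
  (\<open>semiclosedin_iff_interior_of_closure_of\<close>). The equivalence thus holds set by set,
  and applies to each preimage of an open set.\<close>

lemma semiclosedin_iff_interior_of_closure_of:
  "semiclosedin X A \<longleftrightarrow> A \<subseteq> topspace X \<and> X interior_of (X closure_of A) \<subseteq> A"
proof -
  have "X closure_of (X interior_of (topspace X - A))
      = topspace X - X interior_of (X closure_of A)"
    by (simp add: interior_of_complement closure_of_complement)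
  \<comment> \<open>Inside \<open>topspace X\<close>, an inclusion between complements reverses to
    one between the sets.\<close>
  moreover have "X interior_of (X closure_of A) \<subseteq> topspace X"
    by (rule interior_of_subset_topspace)
  ultimately show ?thesis
    unfolding semiclosedin_def semiopenin_def by blast
qed

lemma regular_openin_iff_preopenin_semiclosedin:
  "regular_openin X A \<longleftrightarrow> preopenin X A \<and> semiclosedin X A"
proof -
  \<comment> \<open>Gives a regular open \<open>A\<close> the bound
    \<open>A \<subseteq> topspace X\<close> that semi-closedness demands.\<close>
  have "X interior_of (X closure_of A) \<subseteq> topspace X"
    by (rule interior_of_subset_topspace)
  then show ?thesis
    unfolding regular_openin_def preopenin_def semiclosedin_iff_interior_of_closure_of
    by blast
qed

theorem theorem3p9:
  fixes X :: "'a topology" and Y :: "'b topology" and f :: "'a \<Rightarrow> 'b"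
  assumes "f \<in> topspace X \<rightarrow> topspace Y"
  shows "completely_continuous_map X Y f \<longleftrightarrow>
         precontinuous_map X Y f \<and> contra_semicontinuous_map X Y f"
  unfolding completely_continuous_map_def precontinuous_map_def contra_semicontinuous_map_def
    regular_openin_iff_preopenin_semiclosedin
  by blast

end
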